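(* Suppose that every infinite bridgeless cubic graph contains three (not necessarily distinct) perfect matchings $M_1,M_2,M_3$ such that $M_1\cap M_2\cap M_3=\emptyset$. Then every infinite bridgeless cubic graph has two (not necessarily distinct) perfect matchings $M_1,M_2$ such that $M_1\cap M_2$ does not contain an odd edge-cut.
   Context: Graphs are simple (no loops, no parallel edges), not necessarily connected, and may be infinite. A graph is cubic if every vertex has degree exactly 3, and bridgeless if it has no edge whose deletion increases the number of connected components. A perfect matching of $G$ is a set $M\subseteq E(G)$ such that every vertex of $G$ is incident with exactly one edge of $M$. An edge-cut of $G$ is a set of edges of the form $E_G(A,B)$, the set of all edges of $G$ with one endpoint in $A$ and the other in $B$, where $\{A,B\}$ is a partition of $V(G)$ into two nonempty sets. An odd edge-cut is an edge-cut that is finite and has odd cardinality. *)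

theory Defs
  imports Main
begin

text \<open>
  A graph is given by a vertex set \<open>V\<close> and a set \<open>E\<close> of two-element subsets of \<open>V\<close>.
\<close>

definition simple_graph :: "'a set \<Rightarrow> 'a set set \<Rightarrow> bool" where
  "simple_graph V E \<longleftrightarrow> (\<forall>e\<in>E. e \<subseteq> V \<and> card e = 2)"

definition cubic :: "'a set \<Rightarrow> 'a set set \<Rightarrow> bool" where
  "cubic V E \<longleftrightarrow> (\<forall>v\<in>V. card {e \<in> E. v \<in> e} = 3)"

definition connected_rel :: "'a set \<Rightarrow> 'a set set \<Rightarrow> 'a rel" where
  "connected_rel V E = {(u, v). u \<in> V \<and> v \<in> V \<and> (u, v) \<in> {(x, y). {x, y} \<in> E}\<^sup>*}"

definition components :: "'a set \<Rightarrow> 'a set set \<Rightarrow> 'a set set" where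
  "components V E = V // connected_rel V E"

text \<open>
  A bridge is an edge whose deletion increases the number of components. As a graph may have
  infinitely many components, the increase is measured inside a single component \<open>C\<close>: after
  the deletion, \<open>C\<close> consists of more than one component. Deleting one edge leaves at most two
  components inside \<open>C\<close>, so the cardinality below is that of a finite set.
\<close>

definition is_bridge :: "'a set \<Rightarrow> 'a set set \<Rightarrow> 'a set \<Rightarrow> bool" where
  "is_bridge V E e \<longleftrightarrow> e \<in> E \<and>
     (\<exists>C \<in> components V E. card {D \<in> components V (E - {e}). D \<subseteq> C} > 1)"

definition bridgeless :: "'a set \<Rightarrow> 'a set set \<Rightarrow> bool" where
  "bridgeless V E \<longleftrightarrow> \<not> (\<exists>e. is_bridge V E e)"

definition infinite_bridgeless_cubic_graph :: "'a set \<Rightarrow> 'a set set \<Rightarrow> bool" where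
  "infinite_bridgeless_cubic_graph V E \<longleftrightarrow>
     simple_graph V E \<and> infinite V \<and> cubic V E \<and> bridgeless V E"

definition perfect_matching :: "'a set \<Rightarrow> 'a set set \<Rightarrow> 'a set set \<Rightarrow> bool" where
  "perfect_matching V E M \<longleftrightarrow> M \<subseteq> E \<and> (\<forall>v\<in>V. \<exists>!e. e \<in> M \<and> v \<in> e)"

definition edges_between :: "'a set set \<Rightarrow> 'a set \<Rightarrow> 'a set \<Rightarrow> 'a set set" where
  "edges_between E A B = {e \<in> E. \<exists>a\<in>A. \<exists>b\<in>B. e = {a, b}}"

definition edge_cut :: "'a set \<Rightarrow> 'a set set \<Rightarrow> 'a set set \<Rightarrow> bool" where
  "edge_cut V E F \<longleftrightarrow>
     (\<exists>A B. A \<noteq> {} \<and> B \<noteq> {} \<and> A \<inter> B = {} \<and> A \<union> B = V \<and> F = edges_between E A B)"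

definition odd_edge_cut :: "'a set \<Rightarrow> 'a set set \<Rightarrow> 'a set set \<Rightarrow> bool" where
  "odd_edge_cut V E F \<longleftrightarrow> edge_cut V E F \<and> finite F \<and> odd (card F)"

end

theory Submission
  imports Defs "HOL-Analysis.Function_Topology"
begin

text \<open>
  If an odd cut has a finite side, parity shows that every perfect matching meets it, so three
  perfect matchings with empty intersection yield two whose intersection does not contain the
  cut. The difficulty lies in the cuts with two infinite sides. The requirement on \<open>(M1, M2)\<close> is a
  conjunction of conditions each involving only finitely many edges, so by compactness it suffices
  to treat finitely many vertices and finitely many odd cuts, all inside some finite vertex set
  \<open>X\<close>. Sort the vertices outside \<open>X\<close> by the sides of the cuts on which they lie. Retain one
  infinite class and replace each of the other infinite classes by a finite gadget; the result is
  still an infinite bridgeless cubic graph, it is unchanged on \<open>X\<close>, and each of the chosen cuts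
  now has a finite side, namely the one not containing the retained class.
\<close>

section \<open>Crossing edges, components and bridges\<close>

text \<open>A cut is represented by one of its sides, and \<open>S\<close> may be any set, not just
  a set of vertices of the graph. Thus one \<open>S\<close> can be tested against different graphs,
  and the predicate also expresses that \<open>S\<close> splits a larger set such as a
  gadget.\<close>

definition crosses :: "'a set \<Rightarrow> 'a set \<Rightarrow> bool" where
  "crosses S e \<longleftrightarrow> (\<exists>x\<in>e. x \<in> S) \<and> (\<exists>y\<in>e. y \<notin> S)"

lemma card_two_crossing:
  assumes "card e = 2" "crosses S e"
  obtains x y where "e = {x, y}" "x \<in> S" "y \<notin> S"
proof -
  obtain x y where xy: "x \<in> e" "x \<in> S" "y \<in> e" "y \<notin> S"
    using assms(2) by (auto simp: crosses_def)
  have "finite e" using assms(1) card.infinite by fastforce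
  moreover have "x \<noteq> y" using xy by auto
  ultimately have "{x, y} = e"
    using xy assms(1) by (intro card_subset_eq) auto
  then show ?thesis using that xy by blast
qed

lemma edge_cut_iff_crossing:
  assumes "simple_graph V E" "A \<union> B = V" "A \<inter> B = {}"
  shows "edges_between E A B = {e \<in> E. crosses A e}"
proof (intro set_eqI iffI)
  fix e assume "e \<in> edges_between E A B"
  then show "e \<in> {e \<in> E. crosses A e}"
    using assms(3) by (auto simp: edges_between_def crosses_def)
next
  fix e assume e: "e \<in> {e \<in> E. crosses A e}"
  then have *: "card e = 2" "e \<subseteq> V" using assms(1) by (auto simp: simple_graph_def)
  obtain x y where "e = {x, y}" "x \<in> A" "y \<notin> A"
    using card_two_crossing[OF *(1), of A] e by blast
  then show "e \<in> edges_between E A B"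
    using e * assms(2) by (auto simp: edges_between_def)
qed

abbreviation adj :: "'a set set \<Rightarrow> 'a rel" where
  "adj E \<equiv> {(x, y). {x, y} \<in> E}"

lemma adj_rtrancl_sym: "(x, y) \<in> (adj E)\<^sup>* \<Longrightarrow> (y, x) \<in> (adj E)\<^sup>*"
  by (rule symD[OF sym_rtrancl]) (auto simp: sym_def insert_commute)

lemma equiv_connected_rel: "equiv V (connected_rel V E)"
proof (rule equivI)
  show "connected_rel V E \<subseteq> V \<times> V" by (auto simp: connected_rel_def)
  show "refl_on V (connected_rel V E)"
    by (auto simp: connected_rel_def refl_on_def)
  show "sym (connected_rel V E)"
    by (auto simp: connected_rel_def sym_def intro: adj_rtrancl_sym)
  show "trans (connected_rel V E)"
    by (auto simp: connected_rel_def trans_def)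
qed

lemma connected_rel_mono: "E' \<subseteq> E \<Longrightarrow> connected_rel V E' \<subseteq> connected_rel V E"
  unfolding connected_rel_def
  using rtrancl_mono[of "adj E'" "adj E"] by blast

lemma closed_under_adj:
  assumes "(x, y) \<in> (adj E)\<^sup>*" "x \<in> S" "\<And>e. e \<in> E \<Longrightarrow> \<not> crosses S e"
  shows "y \<in> S"
  using assms(1,2)
proof induction
  case (step y z)
  then show ?case using assms(3)[of "{y, z}"] by (auto simp: crosses_def)
qed

text \<open>Along a path, every use of the deleted edge restarts the walk at \<open>u\<close> or
  \<open>v\<close>. Hence the deletion leaves at most two components inside the old one.\<close>

lemma rtrancl_remove_edge:
  assumes "(u, x) \<in> (adj E)\<^sup>*"
  shows "(u, x) \<in> (adj (E - {{u, v}}))\<^sup>* \<or> (v, x) \<in> (adj (E - {{u, v}}))\<^sup>*"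
  using assms
proof induction
  case (step y z)
  show ?case
  proof (cases "{y, z} = {u, v}")
    case True
    then show ?thesis by (auto simp: doubleton_eq_iff)
  next
    case False
    then have "(y, z) \<in> adj (E - {{u, v}})" using step(2) by auto
    then show ?thesis using step(3) by (meson rtrancl.rtrancl_into_rtrancl)
  qed
qed auto

text \<open>After the deletion no edge joins \<open>S\<close> to its complement, so the two ends of
  \<open>e\<close> fall into different parts of what was one component.\<close>

lemma is_bridge_if_only_crossing:
  assumes G: "simple_graph V E" and e: "e \<in> E" "crosses S e"
    and only: "\<And>f. f \<in> E \<Longrightarrow> f \<noteq> e \<Longrightarrow> \<not> crosses S f"
  shows "is_bridge V E e"
proof -
  have c: "card e = 2" "e \<subseteq> V" using G e by (auto simp: simple_graph_def)
  obtain u v where uv: "e = {u, v}" "u \<in> S" "v \<notin> S"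
    using card_two_crossing[OF c(1) e(2)] .
  have V: "u \<in> V" "v \<in> V" using c uv by auto
  let ?R = "connected_rel V E" and ?R' = "connected_rel V (E - {e})"
  let ?C = "?R `` {u}" and ?Du = "?R' `` {u}" and ?Dv = "?R' `` {v}"
  have uvR: "(u, v) \<in> ?R" using V uv e by (auto simp: connected_rel_def)
  have C: "?C \<in> Defs.components V E" using V by (auto simp: Defs.components_def quotientI)
  have sub: "?R' \<subseteq> ?R" by (rule connected_rel_mono) auto
  have trR: "trans ?R" and symR: "sym ?R" using equiv_connected_rel[of V E] by (auto simp: equiv_def)
  have Du: "?Du \<in> Defs.components V (E - {e})" "?Dv \<in> Defs.components V (E - {e})"
    using V by (auto simp: Defs.components_def quotientI)
  have DC: "?Du \<subseteq> ?C" "?Dv \<subseteq> ?C"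
    using sub uvR trR by (auto dest: transD)
  have "(u, v) \<notin> ?R'"
    using closed_under_adj[of u v "E - {e}" S] uv only by (auto simp: connected_rel_def)
  then have ne: "?Du \<noteq> ?Dv"
    using V by (auto simp: connected_rel_def)
  \<comment> \<open>The set is determined exactly, as \<open>card\<close> would be 0 if it were
    infinite.\<close>
  have "{D \<in> Defs.components V (E - {e}). D \<subseteq> ?C} = {?Du, ?Dv}"
  proof
    show "{?Du, ?Dv} \<subseteq> {D \<in> Defs.components V (E - {e}). D \<subseteq> ?C}" using Du DC by auto
    show "{D \<in> Defs.components V (E - {e}). D \<subseteq> ?C} \<subseteq> {?Du, ?Dv}"
    proof
      fix D assume "D \<in> {D \<in> Defs.components V (E - {e}). D \<subseteq> ?C}"
      then have D: "D \<in> V // ?R'" "D \<subseteq> ?C" by (auto simp: Defs.components_def)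
      then obtain x where x: "x \<in> V" "D = ?R' `` {x}" by (auto elim: quotientE)
      then have "x \<in> D" by (auto simp: connected_rel_def)
      then have "(u, x) \<in> ?R" using D by auto
      then have "(u, x) \<in> ?R' \<or> (v, x) \<in> ?R'"
        using rtrancl_remove_edge[of u x E v] uv V by (auto simp: connected_rel_def)
      then show "D \<in> {?Du, ?Dv}"
        using x equiv_class_eq[OF equiv_connected_rel[of V "E - {e}"]] by blast
    qed
  qed
  then have "card {D \<in> Defs.components V (E - {e}). D \<subseteq> ?C} > 1" using ne by simp
  then show ?thesis unfolding is_bridge_def using e C by blast
qed

text \<open>\<open>S\<close> consists of what can be reached from one end of \<open>e\<close>
  without using \<open>e\<close>. If the other end could be reached as well, deleting
  \<open>e\<close> would change no component.\<close>

lemma bridge_only_crossing: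
  assumes G: "simple_graph V E" and b: "is_bridge V E e"
  obtains S where "crosses S e" "\<And>f. f \<in> E \<Longrightarrow> f \<noteq> e \<Longrightarrow> \<not> crosses S f"
proof -
  have e: "e \<in> E" using b by (auto simp: is_bridge_def)
  then have "card e = 2" "e \<subseteq> V" using G by (auto simp: simple_graph_def)
  then obtain u v where uv: "e = {u, v}" "u \<in> V" "v \<in> V" by (auto simp: card_2_iff)
  let ?R = "connected_rel V E" and ?R' = "connected_rel V (E - {e})"
  let ?S = "{x. (u, x) \<in> (adj (E - {e}))\<^sup>*}"
  have cl: "\<not> crosses ?S f" if f: "f \<in> E" "f \<noteq> e" for f
  proof
    assume cr: "crosses ?S f"
    have "card f = 2" using G f by (auto simp: simple_graph_def)
    from card_two_crossing[OF this cr] obtain x y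
      where xy: "f = {x, y}" "x \<in> ?S" "y \<notin> ?S" .
    then have "(x, y) \<in> adj (E - {e})" using f by auto
    then show False using xy by (auto intro: rtrancl.rtrancl_into_rtrancl)
  qed
  have "v \<notin> ?S"
  proof
    assume v: "v \<in> ?S"
    \<comment> \<open>Each use of \<open>e\<close> can be replaced by the detour from
      \<open>u\<close> to \<open>v\<close> or by its reverse.\<close>
    have "adj E \<subseteq> (adj (E - {e}))\<^sup>*"
      using v adj_rtrancl_sym[of u v "E - {e}"] uv by (auto simp: doubleton_eq_iff)
    then have "(adj E)\<^sup>* \<subseteq> (adj (E - {e}))\<^sup>*" by (rule rtrancl_subset_rtrancl)
    then have "?R \<subseteq> ?R'" by (auto simp: connected_rel_def)
    then have R: "?R = ?R'" using connected_rel_mono[of "E - {e}" E V] by blast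
    obtain C where C: "C \<in> V // ?R" "card {D \<in> V // ?R'. D \<subseteq> C} > 1"
      using b by (auto simp: is_bridge_def Defs.components_def)
    have "{D \<in> V // ?R'. D \<subseteq> C} \<subseteq> {C}"
    proof
      fix D assume D: "D \<in> {D \<in> V // ?R'. D \<subseteq> C}"
      then have "D \<in> V // ?R" "D \<noteq> {}" "D \<subseteq> C"
        using R in_quotient_imp_non_empty[OF equiv_connected_rel] by auto
      then show "D \<in> {C}"
        using quotient_disj[OF equiv_connected_rel, of D V E C] C by auto
    qed
    then have "card {D \<in> V // ?R'. D \<subseteq> C} \<le> card {C}" by (intro card_mono) auto
    then show False using C by simp
  qed
  then have "crosses ?S e" using uv by (auto simp: crosses_def)
  then show ?thesis by (rule that[OF _ cl])
qed

text \<open>Bridgelessness becomes a statement about cuts: none has exactly one edge. The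
  constructions below use this form, so no path has to be followed in a modified graph.\<close>

lemma bridgeless_iff:
  assumes "simple_graph V E"
  shows "bridgeless V E \<longleftrightarrow>
    (\<forall>S. \<forall>e\<in>E. crosses S e \<longrightarrow> (\<exists>f\<in>E. f \<noteq> e \<and> crosses S f))" (is "?L \<longleftrightarrow> ?R")
proof
  assume ?L
  then show ?R using is_bridge_if_only_crossing[OF assms] unfolding bridgeless_def by metis
next
  assume R: ?R
  show ?L unfolding bridgeless_def
  proof
    assume "\<exists>e. is_bridge V E e"
    then obtain e where e: "is_bridge V E e" ..
    obtain S where "crosses S e" "\<And>f. f \<in> E \<Longrightarrow> f \<noteq> e \<Longrightarrow> \<not> crosses S f"
      by (rule bridge_only_crossing[OF assms e]) blast
    then show False using R e unfolding is_bridge_def by metis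
  qed
qed

section \<open>Parity of cuts with a finite side\<close>

text \<open>When incidences between \<open>A\<close> and \<open>H\<close> are counted in two ways,
  an edge inside \<open>A\<close> contributes two and a crossing edge one. With \<open>H\<close>
  arbitrary, the count serves both the whole edge set, with degrees 3, and a perfect matching, with
  degrees 1.\<close>

lemma odd_degrees_crossing_parity:
  assumes "finite A" and H: "\<And>e. e \<in> H \<Longrightarrow> card e = 2"
    and deg: "\<And>v. v \<in> A \<Longrightarrow> odd (card {e \<in> H. v \<in> e})"
  shows "odd (card {e \<in> H. crosses A e}) \<longleftrightarrow> odd (card A)"
proof -
  \<comment> \<open>\<open>H\<close> may be infinite, but an odd \<open>card\<close> is nonzero and
    so belongs to a finite set; hence only finitely many edges meet \<open>A\<close>.\<close>
  let ?T = "{e \<in> H. e \<inter> A \<noteq> {}}"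
  have fin: "finite {e \<in> H. v \<in> e}" if "v \<in> A" for v
    using deg[OF that] by (intro card_ge_0_finite odd_pos)
  have "?T \<subseteq> (\<Union>v\<in>A. {e \<in> H. v \<in> e})" by auto
  then have T: "finite ?T" using fin assms(1) by (meson finite_UN finite_subset)
  have "(\<Sum>v\<in>A. card {e \<in> H. v \<in> e}) = (\<Sum>v\<in>A. card {e \<in> ?T. v \<in> e})"
    by (intro sum.cong refl arg_cong[of _ _ card]) auto
  also have "\<dots> = (\<Sum>e\<in>?T. card {v \<in> A. v \<in> e})"
    by (rule sum_multicount_gen[symmetric]) (use T assms(1) in auto)
  finally have eq: "(\<Sum>v\<in>A. card {e \<in> H. v \<in> e}) = (\<Sum>e\<in>?T. card {v \<in> A. v \<in> e})" .
  have L: "odd (\<Sum>v\<in>A. card {e \<in> H. v \<in> e}) \<longleftrightarrow> odd (card A)"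
  proof -
    have "{v \<in> A. odd (card {e \<in> H. v \<in> e})} = A" using deg by auto
    then show ?thesis using even_sum_iff[OF assms(1), of "\<lambda>v. card {e \<in> H. v \<in> e}"] by simp
  qed
  have odd_iff: "odd (card {v \<in> A. v \<in> e}) \<longleftrightarrow> crosses A e" if e: "e \<in> ?T" for e
  proof -
    have c: "card e = 2" using e H by auto
    then obtain x y where "e = {x, y}" "x \<noteq> y" by (auto simp: card_2_iff)
    moreover have "{v \<in> A. v \<in> {x, y}} = {x, y} \<inter> A" by auto
    ultimately show ?thesis using e by (cases "x \<in> A"; cases "y \<in> A") (auto simp: crosses_def)
  qed
  have "{e \<in> ?T. odd (card {v \<in> A. v \<in> e})} = {e \<in> H. crosses A e}"
    using odd_iff by (auto simp: crosses_def)
  then have "odd (\<Sum>e\<in>?T. card {v \<in> A. v \<in> e}) \<longleftrightarrow> odd (card {e \<in> H. crosses A e})"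
    using even_sum_iff[OF T, of "\<lambda>e. card {v \<in> A. v \<in> e}"] by simp
  then show ?thesis using L eq by simp
qed

text \<open>The cut and its part in \<open>M\<close> both have the parity of the finite side, since
  all degrees are odd in either case. So \<open>M\<close> contains an odd number of edges of the
  cut.\<close>

lemma perfect_matching_meets_odd_cut:
  assumes G: "simple_graph V E" "cubic V E" and M: "perfect_matching V E M"
    and A: "finite (V \<inter> A) \<or> finite (V - A)" and o: "odd (card {e \<in> E. crosses A e})"
  shows "\<exists>e\<in>M. crosses A e"
proof -
  \<comment> \<open>Passing to the complement within \<open>V\<close> affects no crossing, so the
    finite side may stand for the cut.\<close>
  define B where "B = (if finite (V \<inter> A) then V \<inter> A else V - A)"
  have B: "finite B" "B \<subseteq> V" using A by (auto simp: B_def)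
  have ME: "M \<subseteq> E" using M by (auto simp: perfect_matching_def)
  have cr: "crosses B e \<longleftrightarrow> crosses A e" if "e \<in> E" for e
  proof -
    have "e \<subseteq> V" using that G by (auto simp: simple_graph_def)
    then show ?thesis unfolding B_def crosses_def by auto
  qed
  have c2: "card e = 2" if "e \<in> E" for e using that G by (auto simp: simple_graph_def)
  have "{e \<in> E. crosses B e} = {e \<in> E. crosses A e}" using cr by auto
  moreover have "odd (card {e \<in> E. crosses B e}) \<longleftrightarrow> odd (card B)"
    using B G(2) by (intro odd_degrees_crossing_parity) (auto simp: c2 cubic_def)
  moreover have "odd (card {e \<in> M. crosses B e}) \<longleftrightarrow> odd (card B)"
  proof (intro odd_degrees_crossing_parity)
    fix v assume "v \<in> B"
    then have "\<exists>!e. e \<in> M \<and> v \<in> e" using B(2) M unfolding perfect_matching_def by blast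
    then obtain e where "e \<in> M" "v \<in> e" "\<And>f. f \<in> M \<Longrightarrow> v \<in> f \<Longrightarrow> f = e" by metis
    then have "{e \<in> M. v \<in> e} = {e}" by blast
    then show "odd (card {e \<in> M. v \<in> e})" by simp
  qed (use B ME c2 in auto)
  ultimately have "odd (card {e \<in> M. crosses B e})" using o by simp
  then have "{e \<in> M. crosses B e} \<noteq> {}" by (metis card.empty even_zero)
  then show ?thesis using cr ME by auto
qed

section \<open>Compactness for Boolean assignments\<close>

text \<open>By Tychonoff's theorem the Boolean assignments form a compact space. A condition
  depending on finitely many coordinates is closed in it, so the finite intersection property
  applies.\<close>

lemma boolean_compactness:
  fixes \<Phi> :: "('i \<Rightarrow> bool) set set"
  assumes supp: "\<And>\<phi>. \<phi> \<in> \<Phi> \<Longrightarrow> \<exists>T. finite T \<and> (\<forall>f g. (\<forall>i\<in>T. f i = g i) \<longrightarrow> f \<in> \<phi> \<longrightarrow> g \<in> \<phi>)"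
    and fip: "\<And>\<Psi>. finite \<Psi> \<Longrightarrow> \<Psi> \<subseteq> \<Phi> \<Longrightarrow> \<Inter>\<Psi> \<noteq> {}"
  shows "\<Inter>\<Phi> \<noteq> {}"
proof -
  let ?X = "product_topology (\<lambda>_::'i. discrete_topology (UNIV :: bool set)) UNIV"
  have top: "topspace ?X = UNIV" by simp
  have comp: "compact_space ?X"
    by (simp add: compact_space_product_topology compact_space_discrete_topology)
  have "closedin ?X \<phi>" if \<phi>: "\<phi> \<in> \<Phi>" for \<phi>
  proof -
    obtain T where T: "finite T" "\<And>f g. (\<forall>i\<in>T. f i = g i) \<Longrightarrow> f \<in> \<phi> \<Longrightarrow> g \<in> \<phi>"
      using supp[OF \<phi>] by blast
    have "openin ?X (- \<phi>)"
      unfolding openin_product_topology_alt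
    proof
      fix x assume x: "x \<in> - \<phi>"
      \<comment> \<open>An open box around \<open>x\<close>: fixing the coordinates in
        \<open>T\<close> already decides membership in \<open>\<phi>\<close>.\<close>
      let ?U = "\<lambda>i. if i \<in> T then {x i} else UNIV"
      have "Pi\<^sub>E UNIV ?U \<subseteq> - \<phi>"
      proof
        fix y assume "y \<in> Pi\<^sub>E UNIV ?U"
        then have "\<forall>i\<in>T. y i = x i" by (auto simp: PiE_iff split: if_splits)
        then show "y \<in> - \<phi>" using T(2)[of y x] x by auto
      qed
      moreover have "finite {i. ?U i \<noteq> UNIV}"
        by (rule finite_subset[OF _ T(1)]) auto
      ultimately show "\<exists>U. finite {i \<in> UNIV. U i \<noteq> topspace (discrete_topology (UNIV :: bool set))} \<and>
          (\<forall>i\<in>UNIV. openin (discrete_topology UNIV) (U i)) \<and> x \<in> Pi\<^sub>E UNIV U \<and> Pi\<^sub>E UNIV U \<subseteq> - \<phi>"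
        by (intro exI[of _ ?U]) auto
    qed
    then show ?thesis by (simp add: closedin_def top Compl_eq_Diff_UNIV)
  qed
  then show ?thesis using comp fip unfolding compact_space_fip by metis
qed

section \<open>Finite gadgets with a prescribed number of attachment vertices\<close>

text \<open>A gadget closes up the dangling edges attached at \<open>D\<close>: it supplies the missing degrees and,
  being still connected after the loss of any one edge, creates no bridge.\<close>

definition gadget :: "'a set \<Rightarrow> 'a set \<Rightarrow> 'a set set \<Rightarrow> bool" where
  "gadget W D F \<longleftrightarrow> finite W \<and> D \<subseteq> W \<and> (\<forall>e\<in>F. e \<subseteq> W \<and> card e = 2) \<and>
     (\<forall>w\<in>W. card {e \<in> F. w \<in> e} = (if w \<in> D then 2 else 3)) \<and>
     (\<forall>S e. crosses S W \<longrightarrow> (\<exists>f\<in>F. f \<noteq> e \<and> crosses S f))"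

lemma crosses_doubleton [simp]: "crosses S {x, y} \<longleftrightarrow> (x \<in> S) \<noteq> (y \<in> S)"
  by (auto simp: crosses_def)

text \<open>This is the complete graph on four vertices without the edge \<open>{a, d}\<close>,
  whose ends are left with degree 2. Every proper split of the four vertices is crossed by at least
  two edges.\<close>

lemma gadget_diamond:
  assumes "distinct [a, b, c, d]"
  shows "gadget {a, b, c, d} {a, d} {{a, b}, {a, c}, {b, c}, {b, d}, {c, d}}" (is "gadget ?W ?D ?F")
proof -
  have "{e \<in> ?F. a \<in> e} = {{a, b}, {a, c}}" "{e \<in> ?F. b \<in> e} = {{a, b}, {b, c}, {b, d}}"
    "{e \<in> ?F. c \<in> e} = {{a, c}, {b, c}, {c, d}}" "{e \<in> ?F. d \<in> e} = {{b, d}, {c, d}}"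
    using assms by auto
  then have "card {e \<in> ?F. a \<in> e} = 2" "card {e \<in> ?F. b \<in> e} = 3"
    "card {e \<in> ?F. c \<in> e} = 3" "card {e \<in> ?F. d \<in> e} = 2"
    using assms by (simp_all add: doubleton_eq_iff)
  then have deg: "\<forall>w\<in>?W. card {e \<in> ?F. w \<in> e} = (if w \<in> ?D then 2 else 3)"
    using assms by auto
  have cut: "\<exists>f\<in>?F. f \<noteq> e \<and> crosses S f" if S: "crosses S ?W" for S e
  proof -
    have "\<exists>f\<in>?F. \<exists>g\<in>?F. f \<noteq> g \<and> crosses S f \<and> crosses S g"
      using S assms
      by (cases "a \<in> S"; cases "b \<in> S"; cases "c \<in> S"; cases "d \<in> S")
        (simp_all add: crosses_def[of S ?W] doubleton_eq_iff)
    then show ?thesis by metis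
  qed
  show ?thesis unfolding gadget_def using deg cut assms by simp
qed

text \<open>Subdividing an edge creates one more vertex of degree 2, leaves the other degrees alone
  and brings no cut below two edges.\<close>

lemma gadget_subdivide:
  assumes g: "gadget W D F" and uv: "{u, v} \<in> F" and w: "w \<notin> W"
  shows "gadget (insert w W) (insert w D) (F - {{u, v}} \<union> {{u, w}, {w, v}})"
    (is "gadget ?W ?D ?F")
proof -
  have fin: "finite W" "D \<subseteq> W" and FW: "\<And>e. e \<in> F \<Longrightarrow> e \<subseteq> W \<and> card e = 2"
    and deg: "\<And>x. x \<in> W \<Longrightarrow> card {e \<in> F. x \<in> e} = (if x \<in> D then 2 else 3)"
    and cut: "\<And>S e. crosses S W \<Longrightarrow> \<exists>f\<in>F. f \<noteq> e \<and> crosses S f"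
    using g unfolding gadget_def by auto
  have uvW: "u \<in> W" "v \<in> W" "u \<noteq> v" "w \<noteq> u" "w \<noteq> v" using FW[OF uv] w by auto
  have wF: "w \<notin> e" if "e \<in> F" for e using FW[OF that] w by auto
  have deg': "card {e \<in> ?F. x \<in> e} = (if x \<in> ?D then 2 else 3)" if x: "x \<in> ?W" for x
  proof -
    \<comment> \<open>At an end \<open>y\<close> of the subdivided edge, \<open>{y, w}\<close> takes
      the place of \<open>{u, v}\<close>.\<close>
    have swap: "card (insert {y, w} ({e \<in> F. y \<in> e} - {{u, v}})) = card {e \<in> F. y \<in> e}"
      if "y \<in> {u, v}" for y
    proof -
      have "card {e \<in> F. y \<in> e} > 0" using deg[of y] uvW that by auto
      then have f: "finite {e \<in> F. y \<in> e}" by (rule card_ge_0_finite)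
      have "{u, v} \<in> {e \<in> F. y \<in> e}" using that uv by auto
      moreover have "{y, w} \<notin> {e \<in> F. y \<in> e}" using wF by auto
      ultimately show ?thesis using f card_Suc_Diff1[OF f, of "{u, v}"] by simp
    qed
    consider "x = w" | "x = u" | "x = v" | "x \<in> W" "x \<notin> {u, v, w}" using x by auto
    then show ?thesis
    proof cases
      case 1
      then have "{e \<in> ?F. x \<in> e} = {{u, w}, {w, v}}" using wF by auto
      then show ?thesis using 1 uvW by (simp add: doubleton_eq_iff)
    next
      case 2
      then have "x \<notin> {w, v}" using uvW by simp
      then have "{e \<in> ?F. x \<in> e} = insert {x, w} ({e \<in> F. x \<in> e} - {{u, v}})" using 2 by blast
      then show ?thesis using 2 swap[of x] deg[of x] uvW by simp
    next
      case 3
      then have "x \<notin> {u, w}" "{x, w} = {w, v}" using uvW by auto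
      then have "{e \<in> ?F. x \<in> e} = insert {x, w} ({e \<in> F. x \<in> e} - {{u, v}})" using 3 by blast
      then show ?thesis using 3 swap[of x] deg[of x] uvW by simp
    next
      case 4
      then have "{e \<in> ?F. x \<in> e} = {e \<in> F. x \<in> e}" by auto
      then show ?thesis using 4 deg[of x] by simp
    qed
  qed
  have cut': "\<exists>f\<in>?F. f \<noteq> e \<and> crosses S f" if S: "crosses S ?W" for S e
  proof (cases "crosses S W")
    case False
    \<comment> \<open>Here \<open>S\<close> separates the new vertex from all of \<open>W\<close>,
      so both halves cross.\<close>
    then have "crosses S {u, w}" "crosses S {w, v}"
      using S uvW by (auto simp: crosses_def)
    moreover have "{u, w} \<noteq> {w, v}" using uvW by (auto simp: doubleton_eq_iff)
    ultimately show ?thesis by (metis UnI2 insertI1 insertI2)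
  next
    case True
    \<comment> \<open>Excluding a half corresponds to excluding \<open>{u, v}\<close> in the old
      gadget. If the edge found there is \<open>{u, v}\<close> itself, then \<open>e\<close> is
      neither half, and one of the halves crosses \<open>S\<close>.\<close>
    let ?e = "if e \<in> {{u, w}, {w, v}} then {u, v} else e"
    obtain f where f: "f \<in> F" "f \<noteq> ?e" "crosses S f" using cut[OF True] by blast
    show ?thesis
    proof (cases "f = {u, v}")
      case True
      then have "e \<notin> {{u, w}, {w, v}}" "crosses S {u, w} \<or> crosses S {w, v}"
        using f by (auto split: if_splits)
      then show ?thesis by (metis UnI2 insertI1 insertI2)
    next
      case False
      then have "f \<in> ?F" "f \<noteq> e" using f wF[OF f(1)] by (auto split: if_splits)
      then show ?thesis using f(3) by (intro bexI[of _ f] conjI)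
    qed
  qed
  have "\<forall>e\<in>?F. e \<subseteq> ?W \<and> card e = 2" using FW uvW by auto
  moreover have "finite ?W" "?D \<subseteq> ?W" using fin by auto
  ultimately show ?thesis unfolding gadget_def by (intro conjI ballI allI impI deg' cut') auto
qed

text \<open>The empty gadget serves for 0, the diamond for 2, and subdivisions for all larger
  numbers. A single dangling edge would be a bridge, so 1 does not arise. Vertices are taken from
  \<open>P\<close>, so that the modified graph stays over the same type.\<close>

lemma gadget_exists:
  assumes P: "infinite P" and n: "n \<noteq> 1"
  shows "\<exists>W D F. gadget W D F \<and> W \<subseteq> P \<and> card D = n"
proof (cases "n = 0")
  case True
  have "gadget {} {} ({} :: 'a set set)" by (simp add: gadget_def crosses_def)
  then show ?thesis using True by (intro exI[of _ "{}"]) auto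
next
  case False
  then have "2 \<le> n" using n by simp
  then show ?thesis
  proof (induction n rule: dec_induct)
    case base
    obtain T where T: "T \<subseteq> P" "finite T" "card T = 4"
      using infinite_arbitrarily_large[OF P, of 4] by auto
    obtain xs where xs: "set xs = T" "distinct xs" using finite_distinct_list[OF T(2)] by auto
    then have "length xs = 4" using T distinct_card by fastforce
    then obtain a b c d where "xs = [a, b, c, d]"
      by (auto simp: length_Suc_conv numeral_eq_Suc)
    then have "gadget {a, b, c, d} {a, d} {{a, b}, {a, c}, {b, c}, {b, d}, {c, d}}"
      "{a, b, c, d} \<subseteq> P" "card {a, d} = 2"
      using gadget_diamond[of a b c d] xs T by auto
    then show ?case by blast
  next
    case (step n)
    then obtain W D F where g: "gadget W D F" "W \<subseteq> P" "card D = n" by blast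
    have W: "finite W" "D \<subseteq> W" using g by (auto simp: gadget_def)
    \<comment> \<open>A vertex of \<open>D\<close> has degree 2, which provides an edge to
      subdivide.\<close>
    have "D \<noteq> {}" using g step by auto
    then obtain x where "x \<in> D" by auto
    then have "card {e \<in> F. x \<in> e} = 2" using g W by (auto simp: gadget_def)
    then have "{e \<in> F. x \<in> e} \<noteq> {}" by (metis card.empty zero_neq_numeral)
    then obtain e where e: "e \<in> F" by auto
    then have "card e = 2" using g by (auto simp: gadget_def)
    then obtain u v where uv: "e = {u, v}" by (auto simp: card_2_iff)
    obtain w where w: "w \<in> P" "w \<notin> W" using W P by (meson finite_subset subsetI)
    then have "gadget (insert w W) (insert w D) (F - {{u, v}} \<union> {{u, w}, {w, v}})"
      using gadget_subdivide[OF g(1)] e uv by blast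
    moreover have "insert w W \<subseteq> P" using g w by auto
    moreover have "card (insert w D) = Suc n" using g w W by (metis card_insert_disjoint rev_finite_subset subsetD)
    ultimately show ?case by blast
  qed
qed

section \<open>Replacing an infinite vertex class by a gadget\<close>

text \<open>The finitely many edges leaving \<open>P\<close> are redirected to distinct vertices of
  degree 2 in a gadget inside \<open>P\<close>; the rest of \<open>P\<close> is discarded. A cut of
  the new graph either splits the gadget or pulls back to a cut of the old graph, so it never has a
  single edge. The last conclusion records that a redirected edge previously ended in
  \<open>P\<close>, which controls the cuts that do not split \<open>P\<close>.\<close>

lemma replace_by_gadget:
  assumes G: "infinite_bridgeless_cubic_graph V E" and P: "P \<subseteq> V" "infinite P" "infinite (V - P)"
    and bd: "finite {e \<in> E. crosses P e}"
  shows "\<exists>V' E'. infinite_bridgeless_cubic_graph V' E' \<and> V - P \<subseteq> V' \<and> V' \<subseteq> V \<and>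
    finite (V' \<inter> P) \<and> E' \<inter> Pow (V - P) = E \<inter> Pow (V - P) \<and>
    (\<forall>e\<in>E'. e \<subseteq> P \<or> e \<subseteq> V - P \<or>
       (\<exists>x w v. e = {x, w} \<and> x \<notin> P \<and> w \<in> P \<and> v \<in> P \<and> {x, v} \<in> E))"
proof -
  have sg: "simple_graph V E" and cub: "cubic V E" and br: "bridgeless V E"
    using G by (auto simp: infinite_bridgeless_cubic_graph_def)
  have cut: "\<exists>f\<in>E. f \<noteq> e \<and> crosses S f" if "e \<in> E" "crosses S e" for e S
    using br that unfolding bridgeless_iff[OF sg] by blast
  have EV: "e \<subseteq> V" "card e = 2" if "e \<in> E" for e using sg that by (auto simp: simple_graph_def)
  let ?D = "{e \<in> E. crosses P e}"
  have "card ?D \<noteq> 1"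
  proof
    assume "card ?D = 1"
    then obtain e where "?D = {e}" by (auto simp: card_1_singleton_iff)
    then show False using cut[of e P] by blast
  qed
  then obtain W D F where g: "gadget W D F" "W \<subseteq> P" "card D = card ?D"
    using gadget_exists[OF P(2)] by blast
  have fin: "finite W" "D \<subseteq> W" and FW: "\<And>e. e \<in> F \<Longrightarrow> e \<subseteq> W \<and> card e = 2"
    and deg: "\<And>x. x \<in> W \<Longrightarrow> card {e \<in> F. x \<in> e} = (if x \<in> D then 2 else 3)"
    and gcut: "\<And>S e. crosses S W \<Longrightarrow> \<exists>f\<in>F. f \<noteq> e \<and> crosses S f"
    using g unfolding gadget_def by auto
  have "finite D" using fin finite_subset by blast
  then obtain h where h: "bij_betw h ?D D" using bd g(3) finite_same_card_bij by metis
  \<comment> \<open>\<open>h\<close> gives every edge leaving \<open>P\<close> its own gadget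
    vertex, and \<open>\<phi>\<close> moves the inner end of the edge there.\<close>
  define \<phi> where "\<phi> e = (if crosses P e then insert (h e) (e - P) else e)" for e
  define Eo where "Eo = {e \<in> E. \<not> e \<subseteq> P}"
  define V' where "V' = (V - P) \<union> W"
  define E' where "E' = F \<union> \<phi> ` Eo"
  have hD: "h e \<in> D" "h e \<in> W" "h e \<in> P" if "e \<in> E" "crosses P e" for e
    using that h fin g(2) by (auto simp: bij_betw_def)
  have outer: "e \<in> Eo \<Longrightarrow> crosses P e \<or> e \<inter> P = {}" for e
    by (auto simp: Eo_def crosses_def)
  have \<phi>_cross: "\<exists>x p. e = {x, p} \<and> x \<in> V - P \<and> p \<in> P \<and> \<phi> e = {x, h e}"
    if e: "e \<in> E" "crosses P e" for e
  proof -
    obtain p x where "e = {p, x}" "p \<in> P" "x \<notin> P" using card_two_crossing[OF EV(2)] e by metis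
    moreover have "\<phi> e = {x, h e}" using e calculation by (auto simp: \<phi>_def)
    ultimately show ?thesis using EV(1)[OF e(1)] by blast
  qed
  have \<phi>_id: "\<phi> e = e" if "\<not> crosses P e" for e using that by (simp add: \<phi>_def)
  have \<phi>_out: "\<phi> e - P = e - P" if "e \<in> Eo" for e
    using hD[of e] that unfolding \<phi>_def Eo_def by auto
  have inj: "inj_on \<phi> Eo"
  proof (rule inj_onI)
    fix e e' assume ee: "e \<in> Eo" "e' \<in> Eo" "\<phi> e = \<phi> e'"
    have E: "e \<in> E" "e' \<in> E" using ee by (auto simp: Eo_def)
    \<comment> \<open>The trace on \<open>P\<close> tells redirected edges apart through
      \<open>h\<close>, so even edges with the same outer end stay distinct.\<close>
    have tr: "\<phi> f \<inter> P = (if crosses P f then {h f} else {})" if "f \<in> Eo" for f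
      using that outer[OF that] hD[of f] by (auto simp: \<phi>_def Eo_def)
    show "e = e'"
    proof (cases "crosses P e")
      case True
      then have "crosses P e'" "h e = h e'" using tr[OF ee(1)] tr[OF ee(2)] ee(3) by (auto split: if_splits)
      then show ?thesis using h True E by (auto simp: bij_betw_def inj_on_def)
    next
      case False
      then have "\<not> crosses P e'" using tr[OF ee(1)] tr[OF ee(2)] ee(3) by (auto split: if_splits)
      then show ?thesis using False ee(3) by (simp add: \<phi>_id)
    qed
  qed
  have EoV: "\<phi> e \<subseteq> V' \<and> card (\<phi> e) = 2 \<and> \<not> \<phi> e \<subseteq> P" if e: "e \<in> Eo" for e
  proof (cases "crosses P e")
    case True
    have eE: "e \<in> E" using e by (auto simp: Eo_def)
    then obtain x p where "x \<in> V - P" "\<phi> e = {x, h e}" using \<phi>_cross[OF _ True] by blast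
    then show ?thesis using hD[OF eE True] by (auto simp: V'_def card_2_iff)
  next
    case False
    then show ?thesis using e EV[of e] outer[OF e] by (auto simp: \<phi>_id V'_def Eo_def)
  qed
  have sg': "simple_graph V' E'"
    using EoV FW by (auto simp: simple_graph_def E'_def V'_def)
  have cub': "cubic V' E'"
    unfolding cubic_def
  proof
    fix v assume v: "v \<in> V'"
    show "card {e \<in> E'. v \<in> e} = 3"
    proof (cases "v \<in> P")
      case False
      have "{e \<in> E'. v \<in> e} = \<phi> ` {e \<in> E. v \<in> e}"
      proof -
        have "v \<in> \<phi> e \<longleftrightarrow> v \<in> e" if "e \<in> Eo" for e using \<phi>_out[OF that] False by blast
        moreover have "v \<notin> e" if "e \<in> F" for e using FW[OF that] g(2) False by auto
        ultimately show ?thesis using False unfolding E'_def Eo_def by auto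
      qed
      moreover have "inj_on \<phi> {e \<in> E. v \<in> e}"
        by (rule inj_on_subset[OF inj]) (use False in \<open>auto simp: Eo_def\<close>)
      ultimately show ?thesis using v False g(2) cub by (auto simp: card_image V'_def cubic_def)
    next
      case True
      then have vW: "v \<in> W" using v by (auto simp: V'_def)
      have inc: "v \<in> \<phi> e \<longleftrightarrow> crosses P e \<and> h e = v" if "e \<in> Eo" for e
        using outer[OF that] hD[of e] True that by (auto simp: \<phi>_def Eo_def)
      show ?thesis
      proof (cases "v \<in> D")
        case False
        then have "{e \<in> E'. v \<in> e} = {e \<in> F. v \<in> e}"
          using inc hD by (auto simp: E'_def Eo_def)
        then show ?thesis using False deg[OF vW] by simp
      next
        case vD: True
        \<comment> \<open>The gadget gives \<open>v\<close> degree 2; the edge that \<open>h\<close>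
          assigns to \<open>v\<close> supplies the third.\<close>
        then obtain e where e: "e \<in> E" "crosses P e" "h e = v" using h by (auto simp: bij_betw_def)
        then have eo: "e \<in> Eo" by (auto simp: Eo_def crosses_def)
        have uniq: "f = e" if "f \<in> Eo" "crosses P f" "h f = v" for f
          using that e h by (auto simp: bij_betw_def inj_on_def Eo_def)
        have "{e \<in> \<phi> ` Eo. v \<in> e} = {\<phi> e}"
          using uniq inc e eo by blast
        then have "{e \<in> E'. v \<in> e} = insert (\<phi> e) {e \<in> F. v \<in> e}"
          unfolding E'_def by blast
        moreover have "\<phi> e \<notin> F" using EoV[OF eo] FW g(2) by blast
        moreover have "card {e \<in> F. v \<in> e} = 2" using deg[OF vW] vD by simp
        moreover from this have "finite {e \<in> F. v \<in> e}" by (intro card_ge_0_finite) simp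
        ultimately show ?thesis by simp
      qed
    qed
  qed
  have "bridgeless V' E'"
    unfolding bridgeless_iff[OF sg']
  proof (intro allI ballI impI)
    fix S e1 assume e1: "e1 \<in> E'" "crosses S e1"
    show "\<exists>f\<in>E'. f \<noteq> e1 \<and> crosses S f"
    proof (cases "crosses S W")
      case True
      then show ?thesis using gcut[of S e1] unfolding E'_def by blast
    next
      case False
      \<comment> \<open>Since \<open>S\<close> does not split the gadget, all of \<open>P\<close>
        can be put on the gadget's side (inside, if the gadget is empty). This gives a cut of the
        old graph crossed by the corresponding edges.\<close>
      define S' where "S' = (S - P) \<union> (if W \<subseteq> S then P else {})"
      have cr: "crosses S' e \<longleftrightarrow> crosses S (\<phi> e)" if e: "e \<in> Eo" for e
      proof (cases "crosses P e")
        case True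
        have eE: "e \<in> E" using e by (auto simp: Eo_def)
        obtain x p where "e = {x, p}" "x \<in> V - P" "p \<in> P" "\<phi> e = {x, h e}"
          using \<phi>_cross[OF eE True] by blast
        moreover have "h e \<in> S \<longleftrightarrow> W \<subseteq> S" using False hD[OF eE True] by (auto simp: crosses_def)
        ultimately show ?thesis by (auto simp: S'_def)
      next
        case nc: False
        then have "e \<inter> P = {}" using outer[OF e] by blast
        then show ?thesis using \<phi>_id[OF nc] by (auto simp: S'_def crosses_def)
      qed
      have "e1 \<notin> F" using False e1 FW[of e1] by (auto simp: crosses_def)
      then obtain e where e: "e \<in> Eo" "e1 = \<phi> e" using e1 by (auto simp: E'_def)
      then have "e \<in> E" "crosses S' e" using cr e1 by (auto simp: Eo_def)
      then obtain f where f: "f \<in> E" "f \<noteq> e" "crosses S' f" using cut by blast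
      \<comment> \<open>No edge inside \<open>P\<close> crosses \<open>S'\<close>, as
        \<open>P\<close> lies on one side.\<close>
      have "f \<in> Eo" using f by (auto simp: Eo_def S'_def crosses_def split: if_splits)
      then have "\<phi> f \<in> E'" "\<phi> f \<noteq> e1" "crosses S (\<phi> f)"
        using f e inj cr by (auto simp: E'_def inj_on_def)
      then show ?thesis by blast
    qed
  qed
  moreover have "infinite V'" using P(3) by (auto simp: V'_def)
  ultimately have "infinite_bridgeless_cubic_graph V' E'"
    using sg' cub' by (auto simp: infinite_bridgeless_cubic_graph_def)
  moreover have "V - P \<subseteq> V'" "V' \<subseteq> V" using g(2) P(1) by (auto simp: V'_def)
  moreover have "finite (V' \<inter> P)" by (rule finite_subset[OF _ fin(1)]) (auto simp: V'_def)
  moreover have "E' \<inter> Pow (V - P) = E \<inter> Pow (V - P)"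
  proof (intro equalityI subsetI)
    fix e assume e: "e \<in> E' \<inter> Pow (V - P)"
    have "e \<notin> F"
    proof
      assume "e \<in> F"
      then have "e = {}" "card e = 2" using FW g(2) e by blast+
      then show False by simp
    qed
    then obtain e0 where e0: "e0 \<in> Eo" "e = \<phi> e0" using e by (auto simp: E'_def)
    then have "\<not> crosses P e0" using e hD[of e0] by (auto simp: \<phi>_def Eo_def)
    then show "e \<in> E \<inter> Pow (V - P)" using e0 e by (auto simp: \<phi>_id Eo_def)
  next
    fix e assume e: "e \<in> E \<inter> Pow (V - P)"
    then have nc: "\<not> crosses P e" by (auto simp: crosses_def)
    have "e \<noteq> {}" using EV(2)[of e] e by auto
    then have "e \<in> Eo" using e by (auto simp: Eo_def)
    then show "e \<in> E' \<inter> Pow (V - P)" using e \<phi>_id[OF nc] by (force simp: E'_def)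
  qed
  moreover have "e \<subseteq> P \<or> e \<subseteq> V - P \<or>
       (\<exists>x w v. e = {x, w} \<and> x \<notin> P \<and> w \<in> P \<and> v \<in> P \<and> {x, v} \<in> E)" if e: "e \<in> E'" for e
  proof -
    consider "e \<in> F" | e0 where "e0 \<in> Eo" "e = \<phi> e0" using e by (auto simp: E'_def)
    then show ?thesis
    proof cases
      case 1
      then show ?thesis using FW g(2) by blast
    next
      case 2
      then have E0: "e0 \<in> E" by (auto simp: Eo_def)
      show ?thesis
      proof (cases "crosses P e0")
        case True
        obtain x p where "e0 = {x, p}" "x \<in> V - P" "p \<in> P" "\<phi> e0 = {x, h e0}"
          using \<phi>_cross[OF E0 True] by blast
        then show ?thesis using 2 E0 hD[OF E0 True] by blast
      next
        case False
        then show ?thesis using 2 outer[of e0] EV(1)[OF E0] \<phi>_id[OF False] by auto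
      qed
    qed
  qed
  ultimately show ?thesis by (intro exI[of _ V'] exI[of _ E'] conjI ballI)
qed

section \<open>Giving every chosen cut a finite side\<close>

text \<open>Vertices outside \<open>X\<close> are classed by the set of sides that contain them. One
  infinite class \<open>k0\<close> is kept and the others are made finite one at a time. As a class
  lies on one side of each cut, the side opposite to \<open>k0\<close> ends up finite.\<close>

lemma make_cuts_one_sided_finite:
  assumes G: "infinite_bridgeless_cubic_graph V E" and X: "finite X" "X \<subseteq> V" and fin: "finite \<A>"
    and cross: "\<forall>A\<in>\<A>. \<forall>e\<in>E. crosses A e \<longrightarrow> e \<subseteq> X"
  shows "\<exists>V' E'. infinite_bridgeless_cubic_graph V' E' \<and> X \<subseteq> V' \<and> V' \<subseteq> V \<and>
    E' \<inter> Pow X = E \<inter> Pow X \<and> (\<forall>A\<in>\<A>. \<forall>e\<in>E'. crosses A e \<longrightarrow> e \<subseteq> X) \<and>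
    (\<forall>A\<in>\<A>. finite (V' \<inter> A) \<or> finite (V' - A))"
proof -
  define key where "key v = {A \<in> \<A>. v \<in> A}" for v
  define cls where "cls k = {v \<in> V - X. key v = k}" for k
  have "infinite (V - X)" using G X by (auto simp: infinite_bridgeless_cubic_graph_def)
  moreover have keys: "finite (key ` (V - X))"
    by (rule finite_subset[of _ "Pow \<A>"]) (use fin in \<open>auto simp: key_def\<close>)
  ultimately obtain a0 where "a0 \<in> V - X" "infinite {a \<in> V - X. key a = key a0}"
    using pigeonhole_infinite by blast
  define k0 where "k0 = key a0"
  have k0: "infinite (cls k0)" using \<open>infinite {a \<in> V - X. key a = key a0}\<close> by (simp add: cls_def k0_def)
  have key_mem: "v \<in> A \<longleftrightarrow> A \<in> key v" if "A \<in> \<A>" for v A using that by (auto simp: key_def)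
  \<comment> \<open>The classes are fixed by the original graph while the graph changes. Keeping
    \<open>cls k0\<close> in the invariant leaves infinitely many vertices outside the class being
    replaced.\<close>
  have "\<exists>V' E'. infinite_bridgeless_cubic_graph V' E' \<and> X \<subseteq> V' \<and> V' \<subseteq> V \<and>
      E' \<inter> Pow X = E \<inter> Pow X \<and> (\<forall>A\<in>\<A>. \<forall>e\<in>E'. crosses A e \<longrightarrow> e \<subseteq> X) \<and> cls k0 \<subseteq> V' \<and>
      (\<forall>k\<in>K. finite (V' \<inter> cls k))" if K: "finite K" "k0 \<notin> K" for K
    using K
  proof (induction K)
    case empty
    have "cls k0 \<subseteq> V" by (auto simp: cls_def)
    then show ?case using G X cross by (intro exI[of _ V] exI[of _ E]) auto
  next
    case (insert k K)
    then have "k0 \<notin> K" by simp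
    from insert.IH[OF this] obtain V1 E1 where G1: "infinite_bridgeless_cubic_graph V1 E1" and V1: "X \<subseteq> V1" "V1 \<subseteq> V"
      and E1: "E1 \<inter> Pow X = E \<inter> Pow X" and cr1: "\<And>A e. A \<in> \<A> \<Longrightarrow> e \<in> E1 \<Longrightarrow> crosses A e \<Longrightarrow> e \<subseteq> X"
      and k01: "cls k0 \<subseteq> V1" and K1: "\<And>k. k \<in> K \<Longrightarrow> finite (V1 \<inter> cls k)"
      by auto
    show ?case
    proof (cases "finite (V1 \<inter> cls k)")
      case True
      then show ?thesis using G1 V1 E1 cr1 k01 K1 by (intro exI[of _ V1] exI[of _ E1]) auto
    next
      case False
      define P where "P = V1 \<inter> cls k"
      have P: "P \<subseteq> V1" "infinite P" "P \<inter> X = {}" using False by (auto simp: P_def cls_def)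
      have keyP: "v \<in> A \<longleftrightarrow> A \<in> k" if "v \<in> P" "A \<in> \<A>" for v A
        using that key_mem by (auto simp: P_def cls_def)
      have k0P: "cls k0 \<subseteq> V1 - P" using k01 insert.prems by (auto simp: P_def cls_def)
      then have infVP: "infinite (V1 - P)" using k0 finite_subset by blast
      have sg1: "simple_graph V1 E1" and cub1: "cubic V1 E1"
        using G1 by (auto simp: infinite_bridgeless_cubic_graph_def)
      \<comment> \<open>An edge from \<open>P\<close> to a vertex outside \<open>X\<close> would
        join different classes and hence cross a chosen cut, but such edges lie inside
        \<open>X\<close>. So every edge leaving \<open>P\<close> ends in the finite set
        \<open>X\<close>, where degrees are 3.\<close>
      have "{e \<in> E1. crosses P e} \<subseteq> (\<Union>x\<in>X. {e \<in> E1. x \<in> e})"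
      proof
        fix e assume e: "e \<in> {e \<in> E1. crosses P e}"
        then have c: "card e = 2" "e \<subseteq> V1" using sg1 by (auto simp: simple_graph_def)
        obtain p x where px: "e = {p, x}" "p \<in> P" "x \<notin> P"
          using card_two_crossing[OF c(1)] e by blast
        have "x \<in> X"
        proof (rule ccontr)
          assume "x \<notin> X"
          then have "key x \<noteq> key p" using px c V1 by (auto simp: P_def cls_def)
          then obtain A where "A \<in> \<A>" "(x \<in> A) \<noteq> (p \<in> A)" by (auto simp: key_def)
          then have "e \<subseteq> X" using cr1[of A e] e px by auto
          then show False using px P by auto
        qed
        then show "e \<in> (\<Union>x\<in>X. {e \<in> E1. x \<in> e})" using e px by auto
      qed
      moreover have "finite {e \<in> E1. x \<in> e}" if "x \<in> X" for x
      proof (rule card_ge_0_finite)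
        show "card {e \<in> E1. x \<in> e} > 0" using cub1 that V1 by (auto simp: cubic_def)
      qed
      ultimately have bd: "finite {e \<in> E1. crosses P e}"
        using X(1) by (meson finite_UN finite_subset)
      obtain V2 E2 where G2: "infinite_bridgeless_cubic_graph V2 E2" and V2: "V1 - P \<subseteq> V2" "V2 \<subseteq> V1"
        "finite (V2 \<inter> P)" and E2: "E2 \<inter> Pow (V1 - P) = E1 \<inter> Pow (V1 - P)"
        and E2': "\<forall>e\<in>E2. e \<subseteq> P \<or> e \<subseteq> V1 - P \<or>
          (\<exists>x w v. e = {x, w} \<and> x \<notin> P \<and> w \<in> P \<and> v \<in> P \<and> {x, v} \<in> E1)"
        using replace_by_gadget[OF G1 P(1,2) infVP bd] by (elim exE conjE) (rule that)
      have XP: "X \<subseteq> V1 - P" using V1 P by auto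
      have "F \<inter> Pow X = F \<inter> Pow (V1 - P) \<inter> Pow X" for F :: "'a set set" using XP by auto
      then have "E2 \<inter> Pow X = E \<inter> Pow X" using E2 E1 by metis
      moreover have "e \<subseteq> X" if A: "A \<in> \<A>" "e \<in> E2" "crosses A e" for A e
      proof -
        show ?thesis
          using bspec[OF E2' A(2)]
        proof (elim disjE exE conjE)
          assume "e \<subseteq> P"
          then have "\<not> crosses A e" using A(1) keyP unfolding crosses_def by blast
          then show ?thesis using A(3) by simp
        next
          assume "e \<subseteq> V1 - P"
          then have "e \<in> E1" using E2 A by blast
          then show ?thesis using cr1 A by blast
        next
          fix x w v assume *: "e = {x, w}" "x \<notin> P" "w \<in> P" "v \<in> P" "{x, v} \<in> E1"
          \<comment> \<open>Both \<open>v\<close> and \<open>w\<close> lie in \<open>P\<close>,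
            hence on the same side of \<open>A\<close>. So the old edge already crossed
            \<open>A\<close>, which would put \<open>v\<close> into \<open>X\<close>.\<close>
          then have "crosses A {x, v}" using A keyP by auto
          then have "{x, v} \<subseteq> X" using cr1 A * by blast
          then show ?thesis using * P by auto
        qed
      qed
      moreover have "finite (V2 \<inter> cls j)" if "j \<in> insert k K" for j
      proof (cases "j = k")
        case True
        have "V2 \<inter> cls j = V2 \<inter> P" using True V2 by (auto simp: P_def)
        then show ?thesis using V2 by simp
      next
        case False
        then have "finite (V1 \<inter> cls j)" using that K1 by auto
        then show ?thesis by (rule rev_finite_subset) (use V2 in auto)
      qed
      moreover have "X \<subseteq> V2" "V2 \<subseteq> V" "cls k0 \<subseteq> V2" using XP V2 V1 k0P by auto
      ultimately show ?thesis using G2 by (intro exI[of _ V2] exI[of _ E2] conjI ballI impI)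
    qed
  qed
  from this[of "key ` (V - X) - {k0}"] keys obtain V' E'
    where G': "infinite_bridgeless_cubic_graph V' E'" and V': "X \<subseteq> V'" "V' \<subseteq> V"
      "E' \<inter> Pow X = E \<inter> Pow X" "\<forall>A\<in>\<A>. \<forall>e\<in>E'. crosses A e \<longrightarrow> e \<subseteq> X"
      and K: "\<And>k. k \<in> key ` (V - X) - {k0} \<Longrightarrow> finite (V' \<inter> cls k)"
    by auto
  \<comment> \<open>Every vertex of \<open>V'\<close> outside this set belongs to the class
    \<open>k0\<close>.\<close>
  let ?U = "X \<union> (\<Union>k\<in>key ` (V - X) - {k0}. V' \<inter> cls k)"
  have "finite (\<Union>k\<in>key ` (V - X) - {k0}. V' \<inter> cls k)"
    using keys K by (intro finite_UN_I) (rule finite_Diff)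
  then have U: "finite ?U" using X by simp
  have "finite (V' \<inter> A) \<or> finite (V' - A)" if A: "A \<in> \<A>" for A
  proof (cases "A \<in> k0")
    case True
    have "V' - A \<subseteq> ?U"
    proof
      fix v assume v: "v \<in> V' - A"
      then have "key v \<noteq> k0" using key_mem[OF A] True by blast
      then show "v \<in> ?U" using v V' by (auto simp: cls_def)
    qed
    then show ?thesis using U finite_subset by blast
  next
    case False
    have "V' \<inter> A \<subseteq> ?U"
    proof
      fix v assume v: "v \<in> V' \<inter> A"
      then have "key v \<noteq> k0" using key_mem[OF A] False by blast
      then show "v \<in> ?U" using v V' by (auto simp: cls_def)
    qed
    then show ?thesis using U finite_subset by blast
  qed
  then show ?thesis using G' V' by (intro exI[of _ V'] exI[of _ E'] conjI) auto
qed

section \<open>Pairs of perfect matchings by compactness\<close>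

theorem corollary3p5:
  assumes "\<forall>(V :: 'a set) E. infinite_bridgeless_cubic_graph V E \<longrightarrow>
    (\<exists>M1 M2 M3. perfect_matching V E M1 \<and> perfect_matching V E M2 \<and> perfect_matching V E M3 \<and>
       M1 \<inter> M2 \<inter> M3 = {})"
  shows "\<forall>(V :: 'a set) E. infinite_bridgeless_cubic_graph V E \<longrightarrow>
    (\<exists>M1 M2. perfect_matching V E M1 \<and> perfect_matching V E M2 \<and>
       \<not> (\<exists>F. odd_edge_cut V E F \<and> F \<subseteq> M1 \<inter> M2))"
proof (intro allI impI)
  fix V :: "'a set" and E
  assume G: "infinite_bridgeless_cubic_graph V E"
  have sg: "simple_graph V E" and cub: "cubic V E"
    using G by (auto simp: infinite_bridgeless_cubic_graph_def)
  have EV: "e \<subseteq> V" "card e = 2" if "e \<in> E" for e using sg that by (auto simp: simple_graph_def)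
  have fin_inc: "finite {e \<in> E. v \<in> e}" if "v \<in> V" for v
    using cub that by (intro card_ge_0_finite) (auto simp: cubic_def)
  \<comment> \<open>\<open>f\<close> encodes a pair of edge sets: the Boolean selects the member of the pair.\<close>
  define L where "L v = {f :: 'a set \<times> bool \<Rightarrow> bool. \<forall>b. \<exists>!e. e \<in> E \<and> v \<in> e \<and> f (e, b)}" for v
  define C where "C F = {f :: 'a set \<times> bool \<Rightarrow> bool. \<exists>e\<in>F. \<not> (f (e, True) \<and> f (e, False))}" for F
  define \<O> where "\<O> = {F. odd_edge_cut V E F}"
  have "\<Inter> (L ` V \<union> C ` \<O>) \<noteq> {}"
  proof (rule boolean_compactness)
    fix \<phi> assume "\<phi> \<in> L ` V \<union> C ` \<O>"
    then consider v where "v \<in> V" "\<phi> = L v" | F where "F \<in> \<O>" "\<phi> = C F" by blast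
    then show "\<exists>T. finite T \<and> (\<forall>f g. (\<forall>i\<in>T. f i = g i) \<longrightarrow> f \<in> \<phi> \<longrightarrow> g \<in> \<phi>)"
    proof cases
      case 1
      have "g \<in> L v" if fg: "\<forall>i\<in>{e \<in> E. v \<in> e} \<times> UNIV. f i = g i" "f \<in> L v" for f g
      proof -
        have "(e \<in> E \<and> v \<in> e \<and> f (e, b)) \<longleftrightarrow> (e \<in> E \<and> v \<in> e \<and> g (e, b))" for e b using fg(1) by auto
        then show ?thesis using fg(2) by (simp add: L_def)
      qed
      then show ?thesis using 1 fin_inc by (intro exI[of _ "{e \<in> E. v \<in> e} \<times> UNIV"]) auto
    next
      case 2
      have "g \<in> C F" if "\<forall>i\<in>F \<times> UNIV. f i = g i" "f \<in> C F" for f g using that by (auto simp: C_def)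
      then show ?thesis using 2 by (intro exI[of _ "F \<times> UNIV"]) (auto simp: \<O>_def odd_edge_cut_def)
    qed
  next
    fix \<Psi> assume \<Psi>: "finite \<Psi>" "\<Psi> \<subseteq> L ` V \<union> C ` \<O>"
    have "finite (\<Psi> \<inter> L ` V)" "finite (\<Psi> \<inter> C ` \<O>)" using \<Psi> by auto
    then obtain S \<F> where S: "S \<subseteq> V" "finite S" "\<Psi> \<inter> L ` V = L ` S"
      and \<F>: "\<F> \<subseteq> \<O>" "finite \<F>" "\<Psi> \<inter> C ` \<O> = C ` \<F>"
      by (meson finite_subset_image inf_le2)
    have odd_cut: "edge_cut V E F" "finite F" "odd (card F)" if "F \<in> \<F>" for F
      using \<F>(1) that by (auto simp: \<O>_def odd_edge_cut_def)
    have "\<exists>A. F = {e \<in> E. crosses A e}" if F: "F \<in> \<F>" for F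
    proof -
      obtain A B where "A \<union> B = V" "A \<inter> B = {}" "F = edges_between E A B"
        using odd_cut(1)[OF F] unfolding edge_cut_def by (elim exE conjE) (rule that)
      then have "F = {e \<in> E. crosses A e}" using edge_cut_iff_crossing[OF sg] by simp
      then show ?thesis ..
    qed
    then obtain side where side: "\<And>F. F \<in> \<F> \<Longrightarrow> F = {e \<in> E. crosses (side F) e}"
      by metis
    \<comment> \<open>\<open>H\<close> collects the edges on which the chosen conditions depend;
      \<open>X\<close> will contain all their ends, so the modified graph keeps these edges.\<close>
    define H where "H = (\<Union>v\<in>S. {e \<in> E. v \<in> e}) \<union> \<Union>\<F>"
    have "F \<subseteq> E" if "F \<in> \<F>" for F using side[OF that] by blast
    then have H: "finite H" "H \<subseteq> E" using S \<F> fin_inc odd_cut(2) by (auto simp: H_def)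
    define X where "X = \<Union>H \<union> S"
    have finE: "finite e" if "e \<in> E" for e using EV(2)[OF that] by (intro card_ge_0_finite) simp
    have "e \<subseteq> V" "finite e" if "e \<in> H" for e using that H(2) EV(1) finE by blast+
    then have X: "finite X" "X \<subseteq> V" using H(1) S(1,2) by (auto simp: X_def)
    have HX: "e \<subseteq> X" if "e \<in> H" for e using that by (auto simp: X_def)
    have cross: "\<forall>A\<in>side ` \<F>. \<forall>e\<in>E. crosses A e \<longrightarrow> e \<subseteq> X"
    proof (intro ballI impI)
      fix A e assume A: "A \<in> side ` \<F>" "e \<in> E" "crosses A e"
      obtain F where F: "F \<in> \<F>" "A = side F" using A(1) by blast
      then have "e \<in> F" using side[OF F(1)] A by blast
      then show "e \<subseteq> X" using F by (intro HX) (auto simp: H_def)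
    qed
    obtain V' E' where G': "infinite_bridgeless_cubic_graph V' E'" "X \<subseteq> V'" "V' \<subseteq> V"
      "E' \<inter> Pow X = E \<inter> Pow X"
      and cr': "\<forall>A\<in>side ` \<F>. \<forall>e\<in>E'. crosses A e \<longrightarrow> e \<subseteq> X"
      and one: "\<forall>A\<in>side ` \<F>. finite (V' \<inter> A) \<or> finite (V' - A)"
      using make_cuts_one_sided_finite[OF G X finite_imageI[OF \<F>(2)] cross]
      by (elim exE conjE) (rule that)
    have sg': "simple_graph V' E'" and cub': "cubic V' E'"
      using G' by (auto simp: infinite_bridgeless_cubic_graph_def)
    obtain M1 M2 M3 where M: "perfect_matching V' E' M1" "perfect_matching V' E' M2"
      "perfect_matching V' E' M3" "M1 \<inter> M2 \<inter> M3 = {}"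
      using assms G'(1) by metis
    \<comment> \<open>Two matchings of the modified graph, read as an assignment; only the
      conditions in \<open>\<Psi>\<close> are claimed for it.\<close>
    define f where "f = (\<lambda>(e, b). e \<in> (if b then M1 else M2))"
    have "f \<in> L v" if v: "v \<in> S" for v
    proof -
      have vV: "v \<in> V" "v \<in> V'" using v S G' by (auto simp: X_def)
      have "{e \<in> E. v \<in> e} \<subseteq> {e \<in> E'. v \<in> e}"
      proof
        fix e assume e: "e \<in> {e \<in> E. v \<in> e}"
        then have "e \<subseteq> X" using v by (intro HX) (auto simp: H_def)
        then show "e \<in> {e \<in> E'. v \<in> e}" using e G'(4) by blast
      qed
      \<comment> \<open>Both graphs have exactly three edges at \<open>v\<close>, so the inclusion
        is an equality.\<close>
      moreover have "card {e \<in> E. v \<in> e} = 3" "card {e \<in> E'. v \<in> e} = 3"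
        using cub cub' vV by (auto simp: cubic_def)
      moreover from this have "finite {e \<in> E'. v \<in> e}" by (intro card_ge_0_finite) simp
      ultimately have eq: "{e \<in> E. v \<in> e} = {e \<in> E'. v \<in> e}" by (intro card_subset_eq) auto
      have "\<exists>!e. e \<in> E \<and> v \<in> e \<and> e \<in> M" if M: "perfect_matching V' E' M" for M
      proof -
        have "M \<subseteq> E'" "\<exists>!e. e \<in> M \<and> v \<in> e" using M vV unfolding perfect_matching_def by blast+
        moreover have "e \<in> E \<and> v \<in> e \<and> e \<in> M \<longleftrightarrow> e \<in> M \<and> v \<in> e" for e
          using eq \<open>M \<subseteq> E'\<close> by blast
        ultimately show ?thesis by simp
      qed
      then show ?thesis using M by (auto simp: L_def f_def)
    qed
    moreover have "f \<in> C F" if F: "F \<in> \<F>" for F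
    proof -
      \<comment> \<open>In both graphs the edges crossing this cut lie inside \<open>X\<close>,
        where the graphs agree.\<close>
      have "{e \<in> E'. crosses (side F) e} = {e \<in> E. crosses (side F) e}"
      proof -
        have "e \<in> E' \<longleftrightarrow> e \<in> E" if e: "crosses (side F) e" for e
        proof -
          have "e \<in> E' \<Longrightarrow> e \<subseteq> X" using bspec[OF cr' imageI[OF F]] e by blast
          moreover have "e \<in> E \<Longrightarrow> e \<subseteq> X" using bspec[OF cross imageI[OF F]] e by blast
          moreover have "e \<in> E' \<inter> Pow X \<longleftrightarrow> e \<in> E \<inter> Pow X" by (simp only: G'(4))
          ultimately show ?thesis by blast
        qed
        then show ?thesis by blast
      qed
      then have eq: "{e \<in> E'. crosses (side F) e} = F" using side[OF F] by simp
      \<comment> \<open>In the modified graph the odd cut has a finite side, so \<open>M3\<close>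
        meets it in an edge, which cannot lie in both \<open>M1\<close> and
        \<open>M2\<close>.\<close>
      have "\<exists>e\<in>M3. crosses (side F) e"
        by (rule perfect_matching_meets_odd_cut[OF sg' cub' M(3)]) (use one F eq odd_cut(3) in auto)
      then obtain e where e: "e \<in> M3" "crosses (side F) e" by blast
      then have "e \<in> F" using eq M(3) by (auto simp: perfect_matching_def)
      moreover have "e \<notin> M1 \<inter> M2" using e M(4) by blast
      ultimately show ?thesis by (auto simp: C_def f_def)
    qed
    moreover have "\<Psi> = L ` S \<union> C ` \<F>"
      unfolding S(3)[symmetric] \<F>(3)[symmetric] using \<Psi>(2) by blast
    ultimately have "f \<in> \<Inter>\<Psi>" by auto
    then show "\<Inter>\<Psi> \<noteq> {}" by blast
  qed
  then obtain f where f: "\<And>v. v \<in> V \<Longrightarrow> f \<in> L v" "\<And>F. odd_edge_cut V E F \<Longrightarrow> f \<in> C F"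
    by (auto simp: \<O>_def)
  define M where "M b = {e \<in> E. f (e, b)}" for b
  have "perfect_matching V E (M b)" for b
    unfolding perfect_matching_def
  proof (intro conjI ballI)
    show "M b \<subseteq> E" by (auto simp: M_def)
    fix v assume "v \<in> V"
    then have "\<exists>!e. e \<in> E \<and> v \<in> e \<and> f (e, b)" using f(1) by (auto simp: L_def)
    moreover have "e \<in> E \<and> v \<in> e \<and> f (e, b) \<longleftrightarrow> e \<in> M b \<and> v \<in> e" for e by (auto simp: M_def)
    ultimately show "\<exists>!e. e \<in> M b \<and> v \<in> e" by simp
  qed
  moreover have "\<not> (\<exists>F. odd_edge_cut V E F \<and> F \<subseteq> M True \<inter> M False)"
    using f(2) by (fastforce simp: C_def M_def)
  ultimately show "\<exists>M1 M2. perfect_matching V E M1 \<and> perfect_matching V E M2 \<and>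
       \<not> (\<exists>F. odd_edge_cut V E F \<and> F \<subseteq> M1 \<inter> M2)"
    by blast
qed

end
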